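(* Let $m,n$ be positive integers. If $\Lambda_1$ and $\Lambda_2$ are affinely algebraically independent $m$-tuples of (distinct) complex numbers, then $\mathcal{D}_n(\Lambda_1)=\mathcal{D}_n(\Lambda_2)$.
   Context: For a polynomial $P\in\mathbb{C}[x]$ of degree exactly $n$ and an $m$-tuple $\Lambda=(\lambda_1,\ldots,\lambda_m)$ of distinct complex numbers, the dope matrix $D_P(\Lambda)$ is the $m\times(n+1)$ matrix $(c_{ij})$, with $i\in\{1,\ldots,m\}$ and $j\in\{0,1,\ldots,n\}$, where $c_{ij}=1$ if $P^{(j)}(\lambda_i)=0$ and $c_{ij}=0$ otherwise. For fixed $\Lambda$ and $n$ put $\mathcal{D}_n(\Lambda)=\{D_P(\Lambda): P\in\mathbb{C}[x],\ \deg P=n\}$. An affine algebraic dependence of $\Lambda$ is a polynomial $R\in\mathbb{Q}[x_1,\ldots,x_m]$ with $R(a+b\lambda_1,\ldots,a+b\lambda_m)=0$ for all $a,b\in\mathbb{C}$. $\Lambda$ is affinely algebraically independent if its only affine algebraic dependence is $R\equiv 0$. *)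

theory Defs
  imports
    "HOL-Computational_Algebra.Polynomial"
    "HOL-Library.Poly_Mapping"
    "Jordan_Normal_Form.Matrix"
begin

text \<open>An \<open>m\<close>-tuple of complex numbers is a list of length \<open>m\<close>. Its entries, the rows of a
  matrix and the variables of a multivariate polynomial are all numbered from \<open>0\<close> to \<open>m - 1\<close>.\<close>

definition dope_matrix :: "complex poly \<Rightarrow> complex list \<Rightarrow> nat mat" where
  "dope_matrix P \<Lambda> = mat (length \<Lambda>) (degree P + 1)
     (\<lambda>(i, j). if poly ((pderiv ^^ j) P) (\<Lambda> ! i) = 0 then 1 else 0)"

text \<open>The condition \<open>P \<noteq> 0\<close> matters only for \<open>n = 0\<close>, since \<open>degree 0 = 0\<close>.\<close>

definition dope_set :: "nat \<Rightarrow> complex list \<Rightarrow> nat mat set" where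
  "dope_set n \<Lambda> = {dope_matrix P \<Lambda> | P. P \<noteq> 0 \<and> degree P = n}"

text \<open>A finitely supported map \<open>nat \<Rightarrow>\<^sub>0 nat\<close> is a monomial (variable index to exponent), and a
  finitely supported map from monomials to rationals is a polynomial (monomial to coefficient).\<close>

type_synonym rat_mpoly = "(nat \<Rightarrow>\<^sub>0 nat) \<Rightarrow>\<^sub>0 rat"

definition mpolys_in :: "nat \<Rightarrow> rat_mpoly set" where
  "mpolys_in m = {R. \<forall>\<alpha>\<in>Poly_Mapping.keys R. Poly_Mapping.keys \<alpha> \<subseteq> {..<m}}"

definition mpoly_eval :: "rat_mpoly \<Rightarrow> (nat \<Rightarrow> complex) \<Rightarrow> complex" where
  "mpoly_eval R x = (\<Sum>\<alpha>\<in>Poly_Mapping.keys R. of_rat (Poly_Mapping.lookup R \<alpha>) *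
     (\<Prod>i\<in>Poly_Mapping.keys \<alpha>. x i ^ Poly_Mapping.lookup \<alpha> i))"

definition affine_alg_dependence :: "complex list \<Rightarrow> rat_mpoly \<Rightarrow> bool" where
  "affine_alg_dependence \<Lambda> R \<longleftrightarrow> R \<in> mpolys_in (length \<Lambda>) \<and>
     (\<forall>a b. mpoly_eval R (\<lambda>i. a + b * \<Lambda> ! i) = 0)"

definition affinely_alg_independent :: "complex list \<Rightarrow> bool" where
  "affinely_alg_independent \<Lambda> \<longleftrightarrow> (\<forall>R. affine_alg_dependence \<Lambda> R \<longrightarrow> R = 0)"

end

theory Submission imports Defs begin

text \<open>
  For a fixed order \<open>j\<close> and point \<open>x\<close>, the value \<open>P\<^sup>(\<^sup>j\<^sup>)(x)\<close> is a linear form in the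
  coefficients of \<open>P\<close>, and the coefficients of that form are integer multiples of powers of \<open>x\<close>. A
  prescribed dope matrix is therefore a system of linear equations \<open>Z\<close> and linear inequations \<open>N\<close>
  for the coefficient vector of \<open>P\<close>. The requirement \<open>deg P = n\<close> belongs to the inequations, because
  \<open>P\<^sup>(\<^sup>n\<^sup>)\<close> is the constant \<open>n!\<close> times the coefficient of degree \<open>n\<close>.

  A complex vector space is not a finite union of proper subspaces. Hence the system is solvable as
  soon as each single inequation can be satisfied together with all equations
  (\<open>exists_common_nonvanishing\<close>). That one inequation can be separated from the equations does not
  depend on the tuple. Replace the points by indeterminates. Linear algebra over the integral
  domain of rational polynomials (\<open>solvable_or_dependent\<close>) leaves two possibilities. Either there is
  a polynomial vector that satisfies the equations and makes the last form a polynomial \<open>R \<noteq> 0\<close>, or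
  some multiple of the last form by a polynomial \<open>d \<noteq> 0\<close> is a combination of the equations.
  Specialising the indeterminates at a point where \<open>R\<close>, respectively \<open>d\<close>, does not vanish turns the
  first alternative into a complex solution, and the second into a proof that there is none.

  Affine algebraic independence of \<open>\<Lambda>\<close> gives such a point of the form \<open>a + b\<Lambda>\<close> with \<open>b \<noteq> 0\<close>
  (\<open>exists_affine_image_nonvanishing\<close>). The point \<open>\<Lambda>\<close> itself may fail, since its entries may be
  algebraically dependent. The form \<open>a + b\<Lambda>\<close> is good enough, because composing \<open>P\<close> with an
  invertible affine map only multiplies the values \<open>P\<^sup>(\<^sup>j\<^sup>)(\<lambda>\<^sub>i)\<close> by powers of \<open>b\<close>
  (\<open>separable_at_affine_iff\<close>). So solvability over \<open>\<Lambda>\<close> is equivalent to a statement about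
  indeterminates in which \<open>\<Lambda>\<close> enters only through its length
  (\<open>separable_at_iff_generically_separable\<close>).
\<close>

section \<open>Linear systems over an integral domain\<close>

text \<open>Over a field this says that a form vanishing on all common zeros of other forms lies in their span.
  Clearing denominators gives the version for a domain, but a direct induction on \<open>Z\<close> avoids fractions.
  Let \<open>w\<close> be the new form. If a multiple of \<open>w\<close> is spanned by the others, \<open>w\<close> adds no condition.
  Otherwise some solution \<open>u\<close> of the others has \<open>w(u) \<noteq> 0\<close>. In that case \<open>w(u) r - r(u) w\<close> vanishes
  at \<open>u\<close>, and either alternative for this form yields the same alternative for \<open>r\<close>.

  The subring \<open>S\<close> keeps the solution and the multiplier \<open>d\<close> within a given finite set of
  indeterminates.\<close>

lemma solvable_or_dependent:
  fixes L :: "'i \<Rightarrow> 'k \<Rightarrow> 'a::idom" and r :: "'k \<Rightarrow> 'a" and S :: "'a set"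
  assumes one: "1 \<in> S"
    and diff: "\<And>x y. x \<in> S \<Longrightarrow> y \<in> S \<Longrightarrow> x - y \<in> S"
    and mult: "\<And>x y. x \<in> S \<Longrightarrow> y \<in> S \<Longrightarrow> x * y \<in> S"
    and fin: "finite Z" "finite K"
    and L: "\<And>z k. z \<in> Z \<Longrightarrow> k \<in> K \<Longrightarrow> L z k \<in> S"
    and r: "\<And>k. k \<in> K \<Longrightarrow> r k \<in> S"
  shows "(\<exists>v. (\<forall>k\<in>K. v k \<in> S) \<and> (\<forall>z\<in>Z. (\<Sum>k\<in>K. L z k * v k) = 0) \<and> (\<Sum>k\<in>K. r k * v k) \<noteq> 0)
       \<or> (\<exists>d c. d \<in> S \<and> d \<noteq> 0 \<and> (\<forall>k\<in>K. d * r k = (\<Sum>z\<in>Z. c z * L z k)))"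
proof -
  have zero: "0 \<in> S" using diff[OF one one] by simp
  have add: "x + y \<in> S" if "x \<in> S" "y \<in> S" for x y
    using diff[OF that(1) diff[OF zero that(2)]] by simp
  have dot: "(\<Sum>k\<in>K. f k * g k) \<in> S" if "\<And>k. k \<in> K \<Longrightarrow> f k \<in> S" "\<And>k. k \<in> K \<Longrightarrow> g k \<in> S" for f g
    using \<open>finite K\<close> that by (induction K rule: finite_induct) (auto intro: zero add mult)
  show ?thesis
    using fin(1) L r
  proof (induction Z arbitrary: r rule: finite_induct)
    case empty
    show ?case
    proof (cases "\<exists>j\<in>K. r j \<noteq> 0")
      case True
      then obtain j where j: "j \<in> K" "r j \<noteq> 0" by blast
      have "(\<Sum>k\<in>K. r k * (if k = j then 1 else 0)) = r j"
        using j fin by (simp add: if_distrib cong: if_cong)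
      with j one zero show ?thesis
        by (intro disjI1 exI[of _ "\<lambda>k. if k = j then 1 else 0"]) auto
    next
      case False
      then show ?thesis using one by (intro disjI2 exI[of _ 1]) auto
    qed
  next
    case (insert w Z)
    have LZ: "\<And>z k. z \<in> Z \<Longrightarrow> k \<in> K \<Longrightarrow> L z k \<in> S"
      and Lw: "\<And>k. k \<in> K \<Longrightarrow> L w k \<in> S" using insert.prems by auto
    from insert.IH[of "L w", OF LZ Lw] consider
      (solv) u where "\<forall>k\<in>K. u k \<in> S" "\<forall>z\<in>Z. (\<Sum>k\<in>K. L z k * u k) = 0"
        "(\<Sum>k\<in>K. L w k * u k) \<noteq> 0"
      | (dep) d c where "d \<in> S" "d \<noteq> 0" "\<forall>k\<in>K. d * L w k = (\<Sum>z\<in>Z. c z * L z k)"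
      by blast
    then show ?case
    proof cases
      case dep
      have w0: "(\<Sum>k\<in>K. L w k * v k) = 0" if v: "\<forall>z\<in>Z. (\<Sum>k\<in>K. L z k * v k) = 0" for v
      proof -
        have "d * (\<Sum>k\<in>K. L w k * v k) = (\<Sum>k\<in>K. (\<Sum>z\<in>Z. c z * L z k) * v k)"
          using dep by (simp add: sum_distrib_left mult.assoc[symmetric])
        also have "\<dots> = (\<Sum>z\<in>Z. c z * (\<Sum>k\<in>K. L z k * v k))"
          unfolding sum_distrib_left sum_distrib_right mult.assoc by (rule sum.swap)
        finally show ?thesis using v dep(2) by simp
      qed
      from insert.IH[of r, OF LZ insert.prems(2)] show ?thesis
      proof
        assume "\<exists>v. (\<forall>k\<in>K. v k \<in> S) \<and> (\<forall>z\<in>Z. (\<Sum>k\<in>K. L z k * v k) = 0) \<and> (\<Sum>k\<in>K. r k * v k) \<noteq> 0"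
        then show ?thesis using w0 by blast
      next
        assume "\<exists>d c. d \<in> S \<and> d \<noteq> 0 \<and> (\<forall>k\<in>K. d * r k = (\<Sum>z\<in>Z. c z * L z k))"
        then obtain d' c' where d': "d' \<in> S" "d' \<noteq> 0" "\<forall>k\<in>K. d' * r k = (\<Sum>z\<in>Z. c' z * L z k)"
          by blast
        have "(\<Sum>z\<in>Z. (c'(w := 0)) z * L z k) = (\<Sum>z\<in>Z. c' z * L z k)" for k
          using insert.hyps by (intro sum.cong) auto
        with d' insert.hyps show ?thesis
          by (intro disjI2 exI[of _ d'] exI[of _ "c'(w := 0)"]) simp
      qed
    next
      case solv
      define p where "p = (\<Sum>k\<in>K. L w k * u k)"
      define q where "q = (\<Sum>k\<in>K. r k * u k)"
      define r' where "r' k = p * r k - q * L w k" for k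
      have pq: "p \<in> S" "q \<in> S" "p \<noteq> 0"
        unfolding p_def q_def using solv Lw insert.prems(2) by (auto intro!: dot)
      have r'S: "\<And>k. k \<in> K \<Longrightarrow> r' k \<in> S"
        unfolding r'_def using pq Lw insert.prems(2) by (auto intro!: diff mult)
      from insert.IH[of r', OF LZ r'S] show ?thesis
      proof
        assume "\<exists>v. (\<forall>k\<in>K. v k \<in> S) \<and> (\<forall>z\<in>Z. (\<Sum>k\<in>K. L z k * v k) = 0) \<and> (\<Sum>k\<in>K. r' k * v k) \<noteq> 0"
        then obtain v where v: "\<forall>k\<in>K. v k \<in> S" "\<forall>z\<in>Z. (\<Sum>k\<in>K. L z k * v k) = 0"
          "(\<Sum>k\<in>K. r' k * v k) \<noteq> 0" by blast
        \<comment> \<open>The multiple of \<open>u\<close> is chosen so that \<open>w\<close> vanishes at \<open>v'\<close>.\<close>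
        define s where "s = (\<Sum>k\<in>K. L w k * v k)"
        define v' where "v' k = p * v k - s * u k" for k
        have lin: "(\<Sum>k\<in>K. f k * v' k) = p * (\<Sum>k\<in>K. f k * v k) - s * (\<Sum>k\<in>K. f k * u k)" for f
          unfolding v'_def by (simp add: sum_distrib_left sum_subtractf algebra_simps)
        have "(\<Sum>k\<in>K. r' k * v k) = p * (\<Sum>k\<in>K. r k * v k) - q * s"
          unfolding r'_def s_def by (simp add: sum_distrib_left sum_subtractf algebra_simps)
        then have "(\<Sum>k\<in>K. r k * v' k) \<noteq> 0"
          using v(3) lin[of r] by (simp add: q_def[symmetric] mult.commute)
        moreover have "(\<Sum>k\<in>K. L w k * v' k) = 0"
          using lin[of "L w", folded p_def s_def] by (metis mult.commute diff_self)
        moreover have "\<forall>z\<in>Z. (\<Sum>k\<in>K. L z k * v' k) = 0"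
          using lin v(2) solv(2) by simp
        moreover have "\<forall>k\<in>K. v' k \<in> S"
          unfolding v'_def s_def using pq v(1) solv(1) Lw by (auto intro!: diff mult dot)
        ultimately show ?thesis by blast
      next
        assume "\<exists>d c. d \<in> S \<and> d \<noteq> 0 \<and> (\<forall>k\<in>K. d * r' k = (\<Sum>z\<in>Z. c z * L z k))"
        then obtain d c where d: "d \<in> S" "d \<noteq> 0" "\<forall>k\<in>K. d * r' k = (\<Sum>z\<in>Z. c z * L z k)"
          by blast
        have "d * p * r k = (\<Sum>z\<in>insert w Z. (c(w := d * q)) z * L z k)" if "k \<in> K" for k
        proof -
          have "(\<Sum>z\<in>Z. (c(w := d * q)) z * L z k) = (\<Sum>z\<in>Z. c z * L z k)"
            using insert.hyps by (intro sum.cong) auto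
          also have "\<dots> = d * r' k" using d(3) that by simp
          finally show ?thesis using insert.hyps by (simp add: r'_def algebra_simps)
        qed
        moreover have "d * p \<in> S" "d * p \<noteq> 0" using d pq mult by auto
        ultimately show ?thesis by blast
      qed
    qed
  qed
qed

text \<open>On a line \<open>p + tq\<close>, a linear functional that is nonzero at \<open>p\<close> or at \<open>q\<close> vanishes for at most
  one \<open>t \<noteq> 0\<close>, so all but finitely many \<open>t\<close> serve all functionals at once.\<close>

lemma exists_common_nonvanishing:
  fixes f :: "'i \<Rightarrow> complex poly \<Rightarrow> complex"
  assumes lin: "\<And>i t p q. f i (p + Polynomial.smult t q) = f i p + t * f i q"
    and W: "0 \<in> W" "\<And>t p q. p \<in> W \<Longrightarrow> q \<in> W \<Longrightarrow> p + Polynomial.smult t q \<in> W"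
    and "finite N" and "\<And>i. i \<in> N \<Longrightarrow> \<exists>p\<in>W. f i p \<noteq> 0"
  shows "\<exists>p\<in>W. \<forall>i\<in>N. f i p \<noteq> 0"
  using assms(4,5)
proof (induction N rule: finite_induct)
  case empty
  then show ?case using W(1) by blast
next
  case (insert j N)
  obtain p where p: "p \<in> W" "\<forall>i\<in>N. f i p \<noteq> 0" using insert by auto
  obtain q where q: "q \<in> W" "f j q \<noteq> 0" using insert.prems by auto
  \<comment> \<open>Division by zero makes the entry \<open>0\<close> when \<open>f i q = 0\<close>; such \<open>i\<close> need no further exclusion.\<close>
  define B where "B = (\<lambda>i. - (f i p / f i q)) ` insert j N"
  have "finite B" using insert.hyps by (simp add: B_def)
  then have "infinite (UNIV - insert 0 B)"
    using infinite_UNIV_char_0[where ?'a = complex] by simp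
  then obtain t where t: "t \<notin> B" "t \<noteq> 0"
    by (metis Diff_iff insertCI ex_in_conv finite.emptyI)
  have "f i (p + Polynomial.smult t q) \<noteq> 0" if i: "i \<in> insert j N" for i
  proof (cases "f i q = 0")
    case True
    then show ?thesis using i p q by (auto simp: lin)
  next
    case False
    have "t \<noteq> - (f i p / f i q)" using t(1) i unfolding B_def by blast
    then show ?thesis using False by (auto simp: lin field_simps eq_neg_iff_add_eq_0 add.commute)
  qed
  then show ?case using W(2)[OF p(1) q(1)] by blast
qed

section \<open>Evaluation of rational polynomials\<close>

lemma mpoly_eval_0 [simp]: "mpoly_eval 0 x = 0"
  by (simp add: mpoly_eval_def)

lemma mpoly_eval_add: "mpoly_eval (R + S) x = mpoly_eval R x + mpoly_eval S x"
  unfolding mpoly_eval_def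
  by (rule setsum_keys_plus_distrib) (auto simp: of_rat_add algebra_simps)

lemma mpoly_eval_sum: "mpoly_eval (sum f A) x = (\<Sum>a\<in>A. mpoly_eval (f a) x)"
  by (induction A rule: infinite_finite_induct) (auto simp: mpoly_eval_add)

lemma mpoly_eval_single:
  "mpoly_eval (Poly_Mapping.single \<alpha> c) x =
     of_rat c * (\<Prod>i\<in>Poly_Mapping.keys \<alpha>. x i ^ Poly_Mapping.lookup \<alpha> i)"
  by (simp add: mpoly_eval_def)

lemma sum_of_monomials: "(\<Sum>\<alpha>\<in>Poly_Mapping.keys R. Poly_Mapping.single \<alpha> (Poly_Mapping.lookup R \<alpha>)) = R"
  by (rule poly_mapping_eqI)
     (auto simp: lookup_sum lookup_single when_def in_keys_iff)

lemma monomial_value_add: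
  fixes x :: "nat \<Rightarrow> complex" and \<alpha> \<beta> :: "nat \<Rightarrow>\<^sub>0 nat"
  shows "(\<Prod>i\<in>Poly_Mapping.keys (\<alpha> + \<beta>). x i ^ Poly_Mapping.lookup (\<alpha> + \<beta>) i) =
    (\<Prod>i\<in>Poly_Mapping.keys \<alpha>. x i ^ Poly_Mapping.lookup \<alpha> i) *
    (\<Prod>i\<in>Poly_Mapping.keys \<beta>. x i ^ Poly_Mapping.lookup \<beta> i)"
proof -
  let ?K = "Poly_Mapping.keys \<alpha> \<union> Poly_Mapping.keys \<beta>"
  have ext: "(\<Prod>i\<in>Poly_Mapping.keys \<gamma>. x i ^ Poly_Mapping.lookup \<gamma> i) =
      (\<Prod>i\<in>?K. x i ^ Poly_Mapping.lookup \<gamma> i)" if "Poly_Mapping.keys \<gamma> \<subseteq> ?K" for \<gamma>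
    using that by (intro prod.mono_neutral_left) (auto simp: in_keys_iff)
  show ?thesis
    unfolding ext[OF keys_add] ext[OF Un_upper1] ext[OF Un_upper2]
    by (simp add: lookup_add power_add prod.distrib)
qed

lemma mpoly_eval_mult: "mpoly_eval (R * S) x = mpoly_eval R x * mpoly_eval S x"
proof -
  have single: "mpoly_eval (Poly_Mapping.single \<alpha> c * Poly_Mapping.single \<beta> d) x =
      mpoly_eval (Poly_Mapping.single \<alpha> c) x * mpoly_eval (Poly_Mapping.single \<beta> d) x" for \<alpha> \<beta> c d
    by (simp add: mult_single mpoly_eval_single monomial_value_add of_rat_mult)
  have "mpoly_eval (R * S) x = mpoly_eval
      ((\<Sum>\<alpha>\<in>Poly_Mapping.keys R. Poly_Mapping.single \<alpha> (Poly_Mapping.lookup R \<alpha>)) *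
       (\<Sum>\<beta>\<in>Poly_Mapping.keys S. Poly_Mapping.single \<beta> (Poly_Mapping.lookup S \<beta>))) x"
    by (simp only: sum_of_monomials)
  also have "\<dots> = mpoly_eval R x * mpoly_eval S x"
    unfolding sum_product mpoly_eval_sum single
    by (simp only: sum_product[symmetric] mpoly_eval_sum[symmetric] sum_of_monomials)
  finally show ?thesis .
qed

lemma mpoly_eval_1 [simp]: "mpoly_eval 1 x = 1"
  by (simp add: mpoly_eval_single flip: single_one)

lemma mpoly_eval_of_nat [simp]: "mpoly_eval (of_nat k) x = of_nat k"
  by (induction k) (simp_all add: mpoly_eval_add)

lemma mpoly_eval_power: "mpoly_eval (R ^ k) x = mpoly_eval R x ^ k"
  by (induction k) (simp_all add: mpoly_eval_mult)

definition mpoly_var :: "nat \<Rightarrow> rat_mpoly" where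
  "mpoly_var i = Poly_Mapping.single (Poly_Mapping.single i 1) 1"

lemma mpoly_eval_var [simp]: "mpoly_eval (mpoly_var i) x = x i"
  by (simp add: mpoly_var_def mpoly_eval_single)

lemma mpolys_in_1: "1 \<in> mpolys_in m"
  by (simp add: mpolys_in_def)

lemma mpolys_in_0: "0 \<in> mpolys_in m"
  by (simp add: mpolys_in_def)

lemma mpolys_in_add: "R \<in> mpolys_in m \<Longrightarrow> S \<in> mpolys_in m \<Longrightarrow> R + S \<in> mpolys_in m"
  using keys_add[of R S] by (auto simp: mpolys_in_def)

lemma mpolys_in_diff: "R \<in> mpolys_in m \<Longrightarrow> S \<in> mpolys_in m \<Longrightarrow> R - S \<in> mpolys_in m"
  using keys_diff[of R S] by (auto simp: mpolys_in_def)

lemma mpolys_in_mult: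
  assumes "R \<in> mpolys_in m" "S \<in> mpolys_in m"
  shows "R * S \<in> mpolys_in m"
proof -
  have "Poly_Mapping.keys \<gamma> \<subseteq> {..<m}" if \<gamma>: "\<gamma> \<in> Poly_Mapping.keys (R * S)" for \<gamma>
  proof -
    obtain \<alpha> \<beta> where "\<gamma> = \<alpha> + \<beta>" "\<alpha> \<in> Poly_Mapping.keys R" "\<beta> \<in> Poly_Mapping.keys S"
      using subsetD[OF keys_mult \<gamma>] by auto
    then show ?thesis using assms keys_add[of \<alpha> \<beta>] unfolding mpolys_in_def by blast
  qed
  then show ?thesis by (simp add: mpolys_in_def)
qed

lemma mpolys_in_of_nat: "of_nat k \<in> mpolys_in m"
  by (induction k) (auto intro: mpolys_in_0 mpolys_in_1 mpolys_in_add)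

lemma mpolys_in_power: "R \<in> mpolys_in m \<Longrightarrow> R ^ k \<in> mpolys_in m"
  by (induction k) (auto intro: mpolys_in_1 mpolys_in_mult)

lemma mpolys_in_sum: "(\<And>a. a \<in> A \<Longrightarrow> f a \<in> mpolys_in m) \<Longrightarrow> sum f A \<in> mpolys_in m"
  by (induction A rule: infinite_finite_induct) (auto intro: mpolys_in_0 mpolys_in_add)

lemma mpolys_in_var: "i < m \<Longrightarrow> mpoly_var i \<in> mpolys_in m"
  by (simp add: mpolys_in_def mpoly_var_def)

lemma continuous_mpoly_eval_affine:
  "isCont (\<lambda>b. mpoly_eval R (\<lambda>i. a + b * l i)) t"
  unfolding mpoly_eval_def by (intro continuous_intros)

text \<open>Independence only supplies some \<open>a\<close> and \<open>b\<close>, possibly with \<open>b = 0\<close>. Nonvanishing is an open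
  condition on \<open>b\<close>, so a nearby value of \<open>b\<close> is nonzero and still works.\<close>

lemma exists_affine_image_nonvanishing:
  assumes "affinely_alg_independent \<Lambda>" "R \<in> mpolys_in (length \<Lambda>)" "R \<noteq> 0"
  shows "\<exists>a b. b \<noteq> 0 \<and> mpoly_eval R (\<lambda>i. a + b * \<Lambda> ! i) \<noteq> 0"
proof -
  from assms obtain a b where ab: "mpoly_eval R (\<lambda>i. a + b * \<Lambda> ! i) \<noteq> 0"
    unfolding affinely_alg_independent_def affine_alg_dependence_def by blast
  have "\<forall>\<^sub>F c in at b. mpoly_eval R (\<lambda>i. a + c * \<Lambda> ! i) \<noteq> 0"
    using continuous_mpoly_eval_affine[where R = R and a = a and l = "\<lambda>i. \<Lambda> ! i" and t = b] ab
    by (auto simp: isCont_def intro: tendsto_imp_eventually_ne)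
  moreover have "\<forall>\<^sub>F c in at b. c \<noteq> 0"
  proof (cases "b = 0")
    case True
    then show ?thesis by (simp add: eventually_at_filter)
  next
    case False
    then show ?thesis by (intro tendsto_imp_eventually_ne[of "\<lambda>c. c" b]) auto
  qed
  ultimately have "\<forall>\<^sub>F c in at b. c \<noteq> 0 \<and> mpoly_eval R (\<lambda>i. a + c * \<Lambda> ! i) \<noteq> 0"
    by eventually_elim auto
  from eventually_happens'[OF _ this] show ?thesis by auto
qed

section \<open>Derivative conditions as linear forms in the coefficients\<close>

text \<open>The value at \<open>x\<close> of the \<open>j\<close>-th derivative of the monomial of degree \<open>k\<close>; the Pochhammer symbol
  is \<open>k! / (k - j)!\<close>. An arbitrary semiring is allowed so that the same expression can be read
  at a complex number and at an indeterminate.\<close>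

definition deriv_form :: "nat \<Rightarrow> 'a::comm_semiring_1 \<Rightarrow> nat \<Rightarrow> 'a" where
  "deriv_form j x k = (if j \<le> k then of_nat (pochhammer (Suc (k - j)) j) * x ^ (k - j) else 0)"

lemma poly_higher_pderiv_eq_deriv_form:
  fixes p :: "complex poly"
  assumes "degree p \<le> n"
  shows "poly ((pderiv ^^ j) p) x = (\<Sum>k\<le>n. deriv_form j x k * Polynomial.coeff p k)"
proof (cases "j \<le> n")
  case True
  have "poly ((pderiv ^^ j) p) x = (\<Sum>l\<le>n - j. Polynomial.coeff ((pderiv ^^ j) p) l * x ^ l)"
    unfolding poly_altdef using assms
    by (intro sum.mono_neutral_left) (auto simp: degree_higher_pderiv coeff_eq_0)
  also have "\<dots> = (\<Sum>l\<le>n - j. deriv_form j x (l + j) * Polynomial.coeff p (l + j))"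
    by (intro sum.cong)
       (auto simp: coeff_higher_pderiv deriv_form_def pochhammer_of_nat algebra_simps simp flip: of_nat_Suc)
  also have "\<dots> = (\<Sum>k\<in>{j..n}. deriv_form j x k * Polynomial.coeff p k)"
    by (rule sum.reindex_bij_witness[of _ "\<lambda>k. k - j" "\<lambda>l. l + j"]) (use True in auto)
  also have "\<dots> = (\<Sum>k\<le>n. deriv_form j x k * Polynomial.coeff p k)"
    by (rule sum.mono_neutral_left) (auto simp: deriv_form_def)
  finally show ?thesis .
next
  case False
  then have "(pderiv ^^ j) p = 0"
    using assms by (intro poly_eqI) (simp add: coeff_higher_pderiv coeff_eq_0)
  with False show ?thesis by (simp add: deriv_form_def)
qed

lemma mpoly_eval_deriv_form: "mpoly_eval (deriv_form j R k) x = deriv_form j (mpoly_eval R x) k"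
  by (simp add: deriv_form_def mpoly_eval_mult mpoly_eval_power)

lemma mpolys_in_deriv_form: "i < m \<Longrightarrow> deriv_form j (mpoly_var i) k \<in> mpolys_in m"
  by (simp add: deriv_form_def mpolys_in_0 mpolys_in_mult mpolys_in_of_nat mpolys_in_power mpolys_in_var)

lemma poly_higher_pderiv_pcompose_affine:
  fixes p :: "complex poly"
  shows "poly ((pderiv ^^ j) (pcompose p [:a, b:])) x = b ^ j * poly ((pderiv ^^ j) p) (a + b * x)"
proof -
  have "(pderiv ^^ j) (pcompose p [:a, b:]) = Polynomial.smult (b ^ j) (pcompose ((pderiv ^^ j) p) [:a, b:])"
    by (induction j) (simp_all add: pderiv_smult pderiv_pcompose pderiv_pCons mult.commute)
  then show ?thesis by (simp add: poly_pcompose algebra_simps)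
qed

section \<open>Separating one condition from the others\<close>

text \<open>Separability of the condition \<open>r\<close> from the conditions in \<open>Z\<close>: for polynomials of degree at
  most \<open>n\<close>, the equations indexed by \<open>Z\<close> do not force the one indexed by \<open>r\<close>. A pair \<open>(i, j)\<close> stands for the \<open>j\<close>-th derivative at the \<open>i\<close>-th
  point. In the generic version the points are the indeterminates.\<close>

definition separable_at :: "nat \<Rightarrow> (nat \<Rightarrow> complex) \<Rightarrow> (nat \<times> nat) set \<Rightarrow> nat \<times> nat \<Rightarrow> bool" where
  "separable_at n x Z r \<longleftrightarrow> (\<exists>p. degree p \<le> n \<and>
     (\<forall>(i, j)\<in>Z. poly ((pderiv ^^ j) p) (x i) = 0) \<and> poly ((pderiv ^^ snd r) p) (x (fst r)) \<noteq> 0)"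

definition generically_separable :: "nat \<Rightarrow> nat \<Rightarrow> (nat \<times> nat) set \<Rightarrow> nat \<times> nat \<Rightarrow> bool" where
  "generically_separable m n Z r \<longleftrightarrow> (\<exists>v. (\<forall>k\<le>n. v k \<in> mpolys_in m) \<and>
     (\<forall>(i, j)\<in>Z. (\<Sum>k\<le>n. deriv_form j (mpoly_var i) k * v k) = 0) \<and>
     (\<Sum>k\<le>n. deriv_form (snd r) (mpoly_var (fst r)) k * v k) \<noteq> 0)"

lemma separable_at_affine:
  assumes "separable_at n x Z r" "b \<noteq> 0"
  shows "separable_at n (\<lambda>i. a + b * x i) Z r"
proof -
  obtain p where p: "degree p \<le> n" "\<forall>(i, j)\<in>Z. poly ((pderiv ^^ j) p) (x i) = 0"
    "poly ((pderiv ^^ snd r) p) (x (fst r)) \<noteq> 0" using assms(1) unfolding separable_at_def by blast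
  have inv: "- a / b + (1 / b) * (a + b * x i) = x i" for i using assms(2) by (simp add: field_simps)
  have "degree (pcompose p [:- a / b, 1 / b:]) \<le> n"
    using p(1) assms(2) by (simp add: degree_pcompose)
  then show ?thesis
    unfolding separable_at_def using p assms(2)
    by (intro exI[of _ "pcompose p [:- a / b, 1 / b:]"])
       (auto simp: poly_higher_pderiv_pcompose_affine inv simp del: divide_minus_left times_divide_eq_left)
qed

lemma separable_at_affine_iff:
  assumes "b \<noteq> 0"
  shows "separable_at n (\<lambda>i. a + b * x i) Z r \<longleftrightarrow> separable_at n x Z r"
proof
  assume "separable_at n (\<lambda>i. a + b * x i) Z r"
  from separable_at_affine[OF this, of "1 / b" "- a / b"] assms
  show "separable_at n x Z r" by (simp add: field_simps)
qed (rule separable_at_affine[OF _ assms])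

text \<open>The right-hand side does not mention the entries of \<open>\<Lambda>\<close>; this is where independence makes all
  tuples behave alike. A generic solution is specialised where its value \<open>R\<close> on the form \<open>r\<close> is
  nonzero. If there is no generic solution, then \<open>d\<close> times the form \<open>r\<close> is a combination of the forms
  in \<open>Z\<close>. Specialised where \<open>d\<close> is nonzero, this forces the form \<open>r\<close> to vanish on every complex
  solution.\<close>

lemma separable_at_iff_generically_separable:
  assumes ind: "affinely_alg_independent \<Lambda>"
    and Z: "finite Z" "\<And>i j. (i, j) \<in> Z \<Longrightarrow> i < length \<Lambda>" and r: "fst r < length \<Lambda>"
  shows "separable_at n (\<lambda>i. \<Lambda> ! i) Z r \<longleftrightarrow> generically_separable (length \<Lambda>) n Z r"
proof
  assume "generically_separable (length \<Lambda>) n Z r"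
  then obtain v where v: "\<forall>k\<le>n. v k \<in> mpolys_in (length \<Lambda>)"
      "\<forall>(i, j)\<in>Z. (\<Sum>k\<le>n. deriv_form j (mpoly_var i) k * v k) = 0"
      "(\<Sum>k\<le>n. deriv_form (snd r) (mpoly_var (fst r)) k * v k) \<noteq> 0"
    unfolding generically_separable_def by blast
  have "(\<Sum>k\<le>n. deriv_form (snd r) (mpoly_var (fst r)) k * v k) \<in> mpolys_in (length \<Lambda>)"
    using v(1) r by (intro mpolys_in_sum mpolys_in_mult mpolys_in_deriv_form) auto
  from exists_affine_image_nonvanishing[OF ind this v(3)] obtain a b where b: "b \<noteq> 0" and
    ne: "mpoly_eval (\<Sum>k\<le>n. deriv_form (snd r) (mpoly_var (fst r)) k * v k) (\<lambda>i. a + b * \<Lambda> ! i) \<noteq> 0"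
    by blast
  let ?x = "\<lambda>i. a + b * \<Lambda> ! i"
  define p where "p = (\<Sum>k\<le>n. Polynomial.monom (mpoly_eval (v k) ?x) k)"
  have deg: "degree p \<le> n"
    unfolding p_def by (intro degree_sum_le) (auto intro: order_trans[OF degree_monom_le])
  have co: "Polynomial.coeff p k = mpoly_eval (v k) ?x" if "k \<le> n" for k
    using that by (simp add: p_def coeff_sum)
  have val: "poly ((pderiv ^^ j) p) (?x i) = mpoly_eval (\<Sum>k\<le>n. deriv_form j (mpoly_var i) k * v k) ?x" for i j
    unfolding poly_higher_pderiv_eq_deriv_form[OF deg]
    by (simp add: co mpoly_eval_sum mpoly_eval_mult mpoly_eval_deriv_form)
  have "separable_at n ?x Z r"
    unfolding separable_at_def
    by (intro exI[of _ p] conjI deg) (use v(2) ne in \<open>auto simp: val\<close>)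
  then show "separable_at n (\<lambda>i. \<Lambda> ! i) Z r" using separable_at_affine_iff[OF b] by blast
next
  assume sep: "separable_at n (\<lambda>i. \<Lambda> ! i) Z r"
  let ?L = "\<lambda>z. deriv_form (snd z) (mpoly_var (fst z))"
  show "generically_separable (length \<Lambda>) n Z r"
  proof (rule ccontr)
    assume "\<not> generically_separable (length \<Lambda>) n Z r"
    then have "\<not> (\<exists>v. (\<forall>k\<in>{..n}. v k \<in> mpolys_in (length \<Lambda>)) \<and>
        (\<forall>z\<in>Z. (\<Sum>k\<le>n. ?L z k * v k) = 0) \<and> (\<Sum>k\<le>n. ?L r k * v k) \<noteq> 0)"
      by (simp add: generically_separable_def case_prod_unfold Ball_def)
    moreover have "?L z k \<in> mpolys_in (length \<Lambda>)" if "z \<in> Z" for z k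
      using that Z(2)[of "fst z" "snd z"] by (simp add: mpolys_in_deriv_form)
    moreover have "?L r k \<in> mpolys_in (length \<Lambda>)" for k
      using r by (rule mpolys_in_deriv_form)
    ultimately have "\<exists>d c. d \<in> mpolys_in (length \<Lambda>) \<and> d \<noteq> 0 \<and>
        (\<forall>k\<in>{..n}. d * ?L r k = (\<Sum>z\<in>Z. c z * ?L z k))"
      using solvable_or_dependent[OF mpolys_in_1 mpolys_in_diff mpolys_in_mult Z(1) finite_atMost,
          of "length \<Lambda>" n ?L "?L r"] by blast
    then obtain d c where d: "d \<in> mpolys_in (length \<Lambda>)" "d \<noteq> 0"
        and dep: "\<forall>k\<in>{..n}. d * ?L r k = (\<Sum>z\<in>Z. c z * ?L z k)" by blast
    from exists_affine_image_nonvanishing[OF ind d] obtain a b where b: "b \<noteq> 0" and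
      ne: "mpoly_eval d (\<lambda>i. a + b * \<Lambda> ! i) \<noteq> 0" by blast
    let ?x = "\<lambda>i. a + b * \<Lambda> ! i"
    from separable_at_affine[OF sep b, of a] obtain p where p: "degree p \<le> n"
      "\<forall>(i, j)\<in>Z. poly ((pderiv ^^ j) p) (?x i) = 0" "poly ((pderiv ^^ snd r) p) (?x (fst r)) \<noteq> 0"
      unfolding separable_at_def by blast
    have "mpoly_eval d ?x * poly ((pderiv ^^ snd r) p) (?x (fst r))
        = (\<Sum>k\<le>n. mpoly_eval (d * ?L r k) ?x * Polynomial.coeff p k)"
      unfolding poly_higher_pderiv_eq_deriv_form[OF p(1)]
      by (simp add: sum_distrib_left mpoly_eval_mult mpoly_eval_deriv_form mult.assoc)
    also have "\<dots> = (\<Sum>k\<le>n. \<Sum>z\<in>Z. mpoly_eval (c z) ?x * (deriv_form (snd z) (?x (fst z)) k * Polynomial.coeff p k))"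
      using dep by (simp add: mpoly_eval_sum mpoly_eval_mult mpoly_eval_deriv_form sum_distrib_right mult.assoc)
    also have "\<dots> = (\<Sum>z\<in>Z. mpoly_eval (c z) ?x * poly ((pderiv ^^ snd z) p) (?x (fst z)))"
      unfolding poly_higher_pderiv_eq_deriv_form[OF p(1)] by (subst sum.swap) (simp add: sum_distrib_left)
    also have "\<dots> = 0" using p(2) by (intro sum.neutral) auto
    finally show False using ne p(3) by simp
  qed
qed

section \<open>Comparison of dope matrices\<close>

text \<open>Every position where the derivative of \<open>P\<close> does not vanish is separable, over \<open>\<Lambda>\<^sub>1\<close>, from the
  positions where it does, as \<open>P\<close> itself shows; hence the same holds over \<open>\<Lambda>\<^sub>2\<close>. One polynomial \<open>Q\<close>
  then serves all nonvanishing positions at once. The derivative of order \<open>n\<close> of \<open>P\<close> vanishes nowhere,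
  so the last entry of any row forces \<open>Q\<close> to have degree \<open>n\<close>.\<close>

lemma dope_set_subset:
  assumes "length \<Lambda>\<^sub>1 = m" "length \<Lambda>\<^sub>2 = m" "m > 0"
    and ind: "affinely_alg_independent \<Lambda>\<^sub>1" "affinely_alg_independent \<Lambda>\<^sub>2"
  shows "dope_set n \<Lambda>\<^sub>1 \<subseteq> dope_set n \<Lambda>\<^sub>2"
proof
  fix D assume "D \<in> dope_set n \<Lambda>\<^sub>1"
  then obtain P where P: "P \<noteq> 0" "degree P = n" and D: "D = dope_matrix P \<Lambda>\<^sub>1"
    unfolding dope_set_def by blast
  let ?zero = "\<lambda>(i, j). poly ((pderiv ^^ j) P) (\<Lambda>\<^sub>1 ! i) = 0"
  define Z where "Z = {z \<in> {..<m} \<times> {..n}. ?zero z}"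
  define N where "N = {z \<in> {..<m} \<times> {..n}. \<not> ?zero z}"
  have fin: "finite Z" "finite N"
    unfolding Z_def N_def by (auto intro: finite_subset[of _ "{..<m} \<times> {..n}"])
  have sep: "separable_at n (\<lambda>i. \<Lambda>\<^sub>2 ! i) Z r" if "r \<in> N" for r
  proof -
    have "fst r < m" "\<And>i j. (i, j) \<in> Z \<Longrightarrow> i < m" using that by (auto simp: N_def Z_def)
    moreover have "separable_at n (\<lambda>i. \<Lambda>\<^sub>1 ! i) Z r"
      unfolding separable_at_def using P that by (intro exI[of _ P]) (auto simp: Z_def N_def)
    ultimately show ?thesis
      using separable_at_iff_generically_separable[OF ind(1) fin(1)]
        separable_at_iff_generically_separable[OF ind(2) fin(1)] assms(1,2) by simp
  qed
  define W where "W = {p. degree p \<le> n \<and> (\<forall>(i, j)\<in>Z. poly ((pderiv ^^ j) p) (\<Lambda>\<^sub>2 ! i) = 0)}"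
  have "\<exists>p\<in>W. \<forall>r\<in>N. poly ((pderiv ^^ snd r) p) (\<Lambda>\<^sub>2 ! fst r) \<noteq> 0"
  proof (rule exists_common_nonvanishing[OF _ _ _ fin(2)])
    show "\<exists>p\<in>W. poly ((pderiv ^^ snd r) p) (\<Lambda>\<^sub>2 ! fst r) \<noteq> 0" if "r \<in> N" for r
      using sep[OF that] by (auto simp: separable_at_def W_def)
  qed (auto simp: W_def higher_pderiv_add higher_pderiv_smult case_prod_unfold
        intro!: degree_add_le intro: order_trans[OF degree_smult_le])
  then obtain Q where Q: "degree Q \<le> n" "\<And>i j. (i, j) \<in> Z \<Longrightarrow> poly ((pderiv ^^ j) Q) (\<Lambda>\<^sub>2 ! i) = 0"
      "\<And>i j. (i, j) \<in> N \<Longrightarrow> poly ((pderiv ^^ j) Q) (\<Lambda>\<^sub>2 ! i) \<noteq> 0"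
    unfolding W_def by force
  have top: "poly ((pderiv ^^ n) p) x = fact n * Polynomial.coeff p n" if "degree p \<le> n" for p :: "complex poly" and x
  proof -
    have "degree ((pderiv ^^ n) p) = 0" using that by (simp add: degree_higher_pderiv)
    then have "poly ((pderiv ^^ n) p) x = Polynomial.coeff ((pderiv ^^ n) p) 0"
      by (auto elim: degree_eq_zeroE)
    then show ?thesis by (simp add: coeff_higher_pderiv pochhammer_fact)
  qed
  have "(0, n) \<in> N" using P \<open>m > 0\<close> by (auto simp: N_def top)
  then have "Polynomial.coeff Q n \<noteq> 0" using Q(3)[of 0 n] top[OF Q(1)] by auto
  then have "Q \<noteq> 0" "degree Q = n" using Q(1) le_degree[of Q n] by auto
  moreover have "dope_matrix Q \<Lambda>\<^sub>2 = D"
    unfolding D dope_matrix_def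
  proof (rule cong_mat)
    fix i j assume "i < length \<Lambda>\<^sub>2" "j < degree Q + 1"
    then have "i < m" "j \<le> n" using assms \<open>degree Q = n\<close> by auto
    then have "poly ((pderiv ^^ j) Q) (\<Lambda>\<^sub>2 ! i) = 0 \<longleftrightarrow> poly ((pderiv ^^ j) P) (\<Lambda>\<^sub>1 ! i) = 0"
      using Q(2)[of i j] Q(3)[of i j] by (auto simp: Z_def N_def)
    then show "(\<lambda>(i, j). if poly ((pderiv ^^ j) Q) (\<Lambda>\<^sub>2 ! i) = 0 then 1 else 0 :: nat) (i, j) =
        (\<lambda>(i, j). if poly ((pderiv ^^ j) P) (\<Lambda>\<^sub>1 ! i) = 0 then 1 else 0) (i, j)"
      by simp
  qed (use assms P \<open>degree Q = n\<close> in auto)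
  ultimately show "D \<in> dope_set n \<Lambda>\<^sub>2" unfolding dope_set_def by blast
qed

theorem theorem1p7:
  fixes m n :: nat and \<Lambda>\<^sub>1 \<Lambda>\<^sub>2 :: "complex list"
  assumes "m > 0" and "n > 0"
    and "length \<Lambda>\<^sub>1 = m" and "distinct \<Lambda>\<^sub>1" and "affinely_alg_independent \<Lambda>\<^sub>1"
    and "length \<Lambda>\<^sub>2 = m" and "distinct \<Lambda>\<^sub>2" and "affinely_alg_independent \<Lambda>\<^sub>2"
  shows "dope_set n \<Lambda>\<^sub>1 = dope_set n \<Lambda>\<^sub>2"
  using assms by (intro equalityI dope_set_subset) auto

end
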